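(* Let $n \geq 1$, let $A = \{a_{i,j}\}_{i,j=1,\ldots,n}$ be a real-valued $n \times n$ matrix, and let $f\colon [0,1[^2 \to \mathbb{R}$ be defined by $$f(x,y) := a_{i,j}, \quad (x,y) \in \left[\tfrac{i-1}{n}, \tfrac{i}{n}\right[ \times \left[\tfrac{j-1}{n}, \tfrac{j}{n}\right[, \qquad i,j = 1,\ldots,n.$$ Let $\mathcal{P}$ be the set of all permutations of $\{1,\ldots,n\}$ and let $\pi^* \in \mathcal{P}$ be a permutation which solves the assignment problem $$\max_{\pi \in \mathcal{P}} \sum_{i=1}^n a_{i,\pi(i)}.$$ Let $C_{\max}$ be the shuffle of $M$ with parameters $\{n, I_n, \pi^*, 1\}$. Then $C_{\max}$ attains the maximum in $$\max_{C \in \mathcal{C}} \int_{[0,1[^2} f(x,y)\, dC(x,y),$$ and this maximal value is $$\int_{[0,1[^2} f(x,y)\, dC_{\max}(x,y) = \frac{1}{n} \sum_{i=1}^n a_{i,\pi^*(i)}.$$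
   Context: Half-open intervals are written $[a,b[ = \{x : a \le x < b\}$. A (two-)copula is a nonnegative function $C\colon [0,1]^2 \to \mathbb{R}$ such that for all $x,y \in [0,1]$: $C(x,0) = C(0,y) = 0$, $C(x,1) = x$, $C(1,y) = y$; and for all $x_1 \le x_2$, $y_1 \le y_2$ in $[0,1]$: $C(x_2,y_2) - C(x_2,y_1) - C(x_1,y_2) + C(x_1,y_1) \ge 0$. The set of all two-copulas is denoted $\mathcal{C}$. Equivalently, a copula is the joint distribution function of two random variables each uniformly distributed on the unit interval. The integral $\int_{[0,1[^2} f\, dC$ is the integral of $f$ with respect to the (Lebesgue–Stieltjes) probability measure whose distribution function is $C$. Shuffles of $M$: let $n \ge 1$, let $s = (s_0,\ldots,s_n)$ with $0 = s_0 < s_1 < \cdots < s_n = 1$ be a partition of the unit interval, let $\pi$ be a permutation of $S_n = \{1,\ldots,n\}$, and let $\omega\colon S_n \to \{-1,1\}$. Define the partition $t = (t_0,\ldots,t_n)$, $0 = t_0 < t_1 < \cdots < t_n = 1$, such that each $[s_{i-1}, s_i[ \times [t_{\pi(i)-1}, t_{\pi(i)}[$ is a square. A copula $C$ is called the shuffle of $M$ with parameters $\{n, s, \pi, \omega\}$ if for every $i \in \{1,\ldots,n\}$: if $\omega(i) = 1$, then $C$ distributes a mass of $s_i - s_{i-1}$ uniformly spread along the diagonal of $[s_{i-1}, s_i[ \times [t_{\pi(i)-1}, t_{\pi(i)}[$, and if $\omega(i) = -1$, then $C$ distributes a mass of $s_i - s_{i-1}$ uniformly spread along the antidiagonal of that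 square. $I_n$ denotes the partition of the unit interval into $n$ intervals of equal length, i.e. $s_i = i/n$. The parameter $\omega = 1$ means the constant function $\omega(i) = 1$ for all $i$. *)

theory Defs
  imports "HOL-Probability.Probability" "HOL-Combinatorics.Permutations"
begin

text \<open>A copula is a function on the closed unit square. It is represented by a total function on
  the reals, and its values outside the unit square play no role in anything below.\<close>

definition copulas :: "(real \<Rightarrow> real \<Rightarrow> real) set" where
  "copulas = {C.
     (\<forall>x\<in>{0..1}. \<forall>y\<in>{0..1}. 0 \<le> C x y) \<and>
     (\<forall>x\<in>{0..1}. C x 0 = 0 \<and> C x 1 = x) \<and>
     (\<forall>y\<in>{0..1}. C 0 y = 0 \<and> C 1 y = y) \<and>
     (\<forall>x\<^sub>1\<in>{0..1}. \<forall>x\<^sub>2\<in>{0..1}. \<forall>y\<^sub>1\<in>{0..1}. \<forall>y\<^sub>2\<in>{0..1}. x\<^sub>1 \<le> x\<^sub>2 \<longrightarrow> y\<^sub>1 \<le> y\<^sub>2 \<longrightarrow>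
        0 \<le> C x\<^sub>2 y\<^sub>2 - C x\<^sub>2 y\<^sub>1 - C x\<^sub>1 y\<^sub>2 + C x\<^sub>1 y\<^sub>1)}"

text \<open>The Lebesgue-Stieltjes measure of a copula: the Borel probability measure on the plane with
  distribution function \<open>C\<close>. Prescribing the distribution function on the closed unit square
  is enough, because the boundary values \<open>C x 0 = C 0 y = 0\<close> and \<open>C 1 1 = 1\<close> force all
  the mass into that square.\<close>

definition copula_measure :: "(real \<Rightarrow> real \<Rightarrow> real) \<Rightarrow> (real \<times> real) measure" where
  "copula_measure C = (THE M. prob_space M \<and> sets M = sets borel \<and>
     (\<forall>x\<in>{0..1}. \<forall>y\<in>{0..1}. measure M ({..x} \<times> {..y}) = C x y))"

definition copula_integral :: "(real \<times> real \<Rightarrow> real) \<Rightarrow> (real \<Rightarrow> real \<Rightarrow> real) \<Rightarrow> real" where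
  "copula_integral f C =
     set_lebesgue_integral (copula_measure C) ({0..<1} \<times> {0..<1}) f"

definition unit_partition :: "nat \<Rightarrow> (nat \<Rightarrow> real) \<Rightarrow> bool" where
  "unit_partition n s \<longleftrightarrow> s 0 = 0 \<and> s n = 1 \<and> (\<forall>i\<in>{1..n}. s (i - 1) < s i)"

text \<open>Probability mass spread uniformly along the line segment from \<open>p\<close> to \<open>q\<close>.\<close>

definition uniform_segment :: "real \<times> real \<Rightarrow> real \<times> real \<Rightarrow> (real \<times> real) measure" where
  "uniform_segment p q = distr (uniform_measure lborel {0..1}) borel (linepath p q)"

text \<open>The partition \<open>t\<close> is determined on \<open>{0..n}\<close> by the requirement that all
  boxes be squares. The end points of the segments that do not belong to the half-open
  square carry no mass.\<close>

definition shuffle_of_M ::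
  "nat \<Rightarrow> (nat \<Rightarrow> real) \<Rightarrow> (nat \<Rightarrow> nat) \<Rightarrow> (nat \<Rightarrow> int) \<Rightarrow> (real \<Rightarrow> real \<Rightarrow> real) \<Rightarrow> bool" where
  "shuffle_of_M n s \<pi> \<omega> C \<longleftrightarrow>
     1 \<le> n \<and> unit_partition n s \<and> \<pi> permutes {1..n} \<and> \<omega> ` {1..n} \<subseteq> {-1, 1} \<and>
     C \<in> copulas \<and>
     (\<exists>t. unit_partition n t \<and>
        (\<forall>i\<in>{1..n}. t (\<pi> i) - t (\<pi> i - 1) = s i - s (i - 1)) \<and>
        (\<forall>i\<in>{1..n}. \<forall>B\<in>sets borel.
           measure (copula_measure C) (B \<inter> ({s (i - 1)..<s i} \<times> {t (\<pi> i - 1)..<t (\<pi> i)})) =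
           (s i - s (i - 1)) *
           measure
             (if \<omega> i = 1
              then uniform_segment (s (i - 1), t (\<pi> i - 1)) (s i, t (\<pi> i))
              else uniform_segment (s (i - 1), t (\<pi> i)) (s i, t (\<pi> i - 1))) B))"

definition equal_partition :: "nat \<Rightarrow> nat \<Rightarrow> real" where
  "equal_partition n i = real i / real n"

end

theory Submission
  imports Defs
begin

text \<open>The integral of \<open>f\<close> against a copula depends only on the masses that the copula puts on the
  \<open>n\<^sup>2\<close> cells of the grid. As both marginals are uniform, these masses have all row and column sums
  equal to \<open>1 / n\<close> (\<open>cell_mass_sums\<close>), so that maximising over copulas is bounded by a linear
  program over scaled doubly stochastic matrices. The shuffle for \<open>\<pi>'\<close> concentrates the mass of row
  \<open>i\<close> in the cell \<open>(i, \<pi>' i)\<close> and so realises \<open>1 / n\<close> times the permutation matrix of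
  \<open>\<pi>'\<close> (\<open>copula_integral_shuffle\<close>).

  It remains to see that no doubly stochastic matrix beats an optimal permutation, which is shown by
  a solution of the dual linear program: since \<open>\<pi>'\<close> is optimal, the digraph on the indices
  with edge weights \<open>a i (\<pi>' j) - a j (\<pi>' j)\<close> has no cycle of positive weight, and longest path weights give
  numbers \<open>p i\<close> and \<open>q j\<close> with \<open>a i (\<pi>' j) \<le> p i + q j\<close>, with equality for \<open>i = j\<close>
  (\<open>doubly_stochastic_le_optimal_assignment\<close>).

  The integral refers to the Lebesgue-Stieltjes measure of a copula through a definite description,
  so that nothing can be said about it before that measure is known to exist and to be unique.
  Existence in two dimensions is obtained from one-dimensional tools: the
  partial derivatives \<open>\<partial>C/\<partial>x (u, q)\<close>, defined as Radon-Nikodym densities, are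
  conditional distribution functions once \<open>q\<close> is restricted to the rationals, and their generalised inverse turns two independent
  uniform variables into a pair with the right law (\<open>copula_measure_exists\<close>).\<close>

section \<open>Duality for the assignment problem\<close>

fun walk_weight :: "('a \<Rightarrow> 'a \<Rightarrow> real) \<Rightarrow> 'a list \<Rightarrow> real" where
  "walk_weight c (x # y # ys) = c x y + walk_weight c (y # ys)"
| "walk_weight c _ = 0"

lemma walk_weight_append:
  "walk_weight c (xs @ y # ys) = walk_weight c (xs @ [y]) + walk_weight c (y # ys)"
  by (induction c xs rule: walk_weight.induct) (cases ys; simp)+

lemma walk_weight_snoc:
  "xs \<noteq> [] \<Longrightarrow> walk_weight c (xs @ [y]) = walk_weight c xs + c (last xs) y"
  by (induction c xs rule: walk_weight.induct) auto

text \<open>The cyclic shift along a list of distinct vertices moves each vertex to its successor and the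
  last one back to the first, so its cost is that of the closed walk. This turns optimality over
  permutations into a statement about cycles of a weighted digraph.\<close>
lemma closed_walk_permutation:
  assumes "distinct (x # xs)"
  shows "\<exists>\<sigma>. \<sigma> permutes set (x # xs) \<and> \<sigma> (last (x # xs)) = x \<and>
    (\<Sum>k\<in>set (x # xs). c k (\<sigma> k)) = walk_weight c (x # xs) + c (last (x # xs)) x"
  using assms
proof (induction xs arbitrary: x)
  case Nil
  show ?case by (intro exI[of _ id]) (auto simp: permutes_id)
next
  case (Cons y ys)
  then obtain \<sigma> where \<sigma>: "\<sigma> permutes set (y # ys)" and close: "\<sigma> (last (y # ys)) = y"
    and sum: "(\<Sum>k\<in>set (y # ys). c k (\<sigma> k)) = walk_weight c (y # ys) + c (last (y # ys)) y"
    by auto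
  define l where "l = last (y # ys)"
  \<comment> \<open>Prefix \<open>x\<close> to the cycle: the vertex \<open>l\<close> that closed it by going to \<open>y\<close> now
    goes to \<open>x\<close>, and \<open>x\<close> goes to \<open>y\<close>.\<close>
  define \<tau> where "\<tau> = Transposition.transpose x y \<circ> \<sigma>"
  have x: "x \<notin> set (y # ys)" using Cons.prems by simp
  have \<tau>: "\<tau> permutes set (x # y # ys)"
    unfolding \<tau>_def
    by (intro permutes_compose permutes_swap_id permutes_subset[OF \<sigma>]) auto
  have l: "l \<in> set (y # ys)" unfolding l_def using last_in_set by blast
  have \<tau>_l: "\<tau> l = x" using close by (simp add: \<tau>_def l_def)
  have \<tau>_x: "\<tau> x = y" using permutes_not_in[OF \<sigma> x] by (simp add: \<tau>_def)
  have \<tau>_k: "\<tau> k = \<sigma> k" if "k \<in> set (y # ys) - {l}" for k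
  proof -
    have "\<sigma> k \<noteq> y"
      using that close permutes_inj[OF \<sigma>] unfolding l_def inj_def by (metis DiffE singletonI)
    moreover have "\<sigma> k \<noteq> x"
      using that x permutes_in_image[OF \<sigma>] by (metis DiffE)
    ultimately show ?thesis by (simp add: \<tau>_def Transposition.transpose_def)
  qed
  have "(\<Sum>k\<in>set (y # ys). c k (\<tau> k)) = c l x + (\<Sum>k\<in>set (y # ys) - {l}. c k (\<sigma> k))"
    using l \<tau>_k \<tau>_l by (subst sum.remove[of _ l]) auto
  also have "\<dots> = c l x - c l y + (\<Sum>k\<in>set (y # ys). c k (\<sigma> k))"
    using l close by (subst (2) sum.remove[of _ l]) (auto simp: l_def)
  finally have "(\<Sum>k\<in>set (y # ys). c k (\<tau> k)) = walk_weight c (y # ys) + c l x"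
    using sum by (simp add: l_def)
  moreover have "(\<Sum>k\<in>set (x # y # ys). c k (\<tau> k)) = c x y + (\<Sum>k\<in>set (y # ys). c k (\<tau> k))"
    using x \<tau>_x by simp
  ultimately show ?case
    using \<tau> \<tau>_l by (intro exI[of _ \<tau>]) (auto simp: l_def)
qed

text \<open>A weighted digraph in which no cycle has positive weight admits a potential: take for
  \<open>p i\<close> the largest weight of a simple path that starts in \<open>i\<close>. Prefixing an edge to a
  path either gives a simple path again or closes a cycle, which can be dropped without loss.\<close>
lemma potential_exists:
  fixes c :: "'a \<Rightarrow> 'a \<Rightarrow> real"
  assumes "finite S"
    and zero: "\<And>i. i \<in> S \<Longrightarrow> c i i = 0"
    and perm: "\<And>\<sigma>. \<sigma> permutes S \<Longrightarrow> (\<Sum>k\<in>S. c k (\<sigma> k)) \<le> 0"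
  obtains p where "\<And>i j. i \<in> S \<Longrightarrow> j \<in> S \<Longrightarrow> c i j + p j \<le> p i"
proof -
  define paths where "paths i = {xs. set (i # xs) \<subseteq> S \<and> distinct (i # xs)}" for i
  define p where "p i = Max ((\<lambda>xs. walk_weight c (i # xs)) ` paths i)" for i
  have fin: "finite (paths i)" for i
    by (rule finite_subset[OF _ finite_subset_distinct[OF \<open>finite S\<close>]]) (auto simp: paths_def)
  have p_ge: "walk_weight c (i # xs) \<le> p i" if "xs \<in> paths i" for i xs
    unfolding p_def using that fin by (intro Max_ge) auto
  have cycle: "walk_weight c (x # xs) + c (last (x # xs)) x \<le> 0"
    if "distinct (x # xs)" "set (x # xs) \<subseteq> S" for x xs
  proof -
    obtain \<sigma> where \<sigma>: "\<sigma> permutes set (x # xs)"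
      and sum: "(\<Sum>k\<in>set (x # xs). c k (\<sigma> k)) = walk_weight c (x # xs) + c (last (x # xs)) x"
      using closed_walk_permutation[OF \<open>distinct (x # xs)\<close>, of c] by blast
    have "(\<Sum>k\<in>set (x # xs). c k (\<sigma> k)) = (\<Sum>k\<in>S. c k (\<sigma> k))"
      using \<open>finite S\<close> that(2) zero permutes_not_in[OF \<sigma>] by (intro sum.mono_neutral_left) auto
    also have "\<dots> \<le> 0" using perm permutes_subset[OF \<sigma> that(2)] by blast
    finally show ?thesis using sum by simp
  qed
  have "c i j + p j \<le> p i" if i: "i \<in> S" and j: "j \<in> S" for i j
  proof (cases "i = j")
    case True
    with zero i show ?thesis by simp
  next
    case False
    have "[] \<in> paths j" using j by (simp add: paths_def)
    then have "p j \<in> (\<lambda>xs. walk_weight c (j # xs)) ` paths j"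
      unfolding p_def using fin by (intro Max_in) auto
    then obtain xs where xs: "xs \<in> paths j" and p_j: "p j = walk_weight c (j # xs)"
      by blast
    show ?thesis
    proof (cases "i \<in> set xs")
      case False
      then have "j # xs \<in> paths i" using xs i \<open>i \<noteq> j\<close> by (auto simp: paths_def)
      from p_ge[OF this] show ?thesis by (simp add: p_j)
    next
      case True
      \<comment> \<open>The walk from \<open>i\<close> over \<open>j\<close> returns to \<open>i\<close>; drop the cycle in front of the second
        visit to \<open>i\<close>.\<close>
      then obtain ys zs where split: "xs = ys @ i # zs" by (meson split_list)
      have "walk_weight c (i # j # ys) + c (last (i # j # ys)) i \<le> 0"
        using xs split i by (intro cycle) (auto simp: paths_def)
      then have "c i j + walk_weight c ((j # ys) @ [i]) \<le> 0"
        by (subst walk_weight_snoc) auto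
      moreover have "zs \<in> paths i" using xs split by (auto simp: paths_def)
      ultimately show ?thesis
        using p_ge[of zs i] walk_weight_append[of c "j # ys" i zs] by (simp add: p_j split)
    qed
  qed
  then show thesis using that by blast
qed

text \<open>Linear programming duality for the assignment problem. After relabelling the columns by
  \<open>\<pi>\<close>, optimality says that the edge weights \<open>a i (\<pi> j) - a j (\<pi> j)\<close> have no positive
  cycle, and a potential for them gives \<open>p\<close> and \<open>q\<close> with \<open>a i (\<pi> j) \<le> p i + q j\<close> and
  equality on the diagonal. Against a matrix with constant row and column sums, the right-hand side
  integrates to the value of the optimal assignment.\<close>
lemma doubly_stochastic_le_optimal_assignment:
  fixes a d :: "'a \<Rightarrow> 'a \<Rightarrow> real"
  assumes "finite S"
    and \<pi>: "\<pi> permutes S"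
    and opt: "\<And>\<sigma>. \<sigma> permutes S \<Longrightarrow> (\<Sum>i\<in>S. a i (\<sigma> i)) \<le> (\<Sum>i\<in>S. a i (\<pi> i))"
    and d: "\<And>i j. i \<in> S \<Longrightarrow> j \<in> S \<Longrightarrow> 0 \<le> d i j"
    and row: "\<And>i. i \<in> S \<Longrightarrow> (\<Sum>j\<in>S. d i j) = s"
    and col: "\<And>j. j \<in> S \<Longrightarrow> (\<Sum>i\<in>S. d i j) = s"
  shows "(\<Sum>i\<in>S. \<Sum>j\<in>S. a i j * d i j) \<le> s * (\<Sum>i\<in>S. a i (\<pi> i))"
proof -
  have "(\<Sum>k\<in>S. a k (\<pi> (\<sigma> k)) - a (\<sigma> k) (\<pi> (\<sigma> k))) \<le> 0" if \<sigma>: "\<sigma> permutes S" for \<sigma>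
    using opt[OF permutes_compose[OF \<sigma> \<pi>]] sum.permute[OF \<sigma>, of "\<lambda>k. a k (\<pi> k)"]
    by (simp add: sum_subtractf o_def)
  then obtain p where p: "\<And>i j. i \<in> S \<Longrightarrow> j \<in> S \<Longrightarrow> a i (\<pi> j) - a j (\<pi> j) + p j \<le> p i"
    using potential_exists[OF \<open>finite S\<close>, of "\<lambda>i j. a i (\<pi> j) - a j (\<pi> j)"] by auto
  define q where "q j = a j (\<pi> j) - p j" for j
  have in_S: "\<pi> j \<in> S" if "j \<in> S" for j using permutes_in_image[OF \<pi>] that by blast
  have "(\<Sum>i\<in>S. \<Sum>j\<in>S. a i j * d i j) = (\<Sum>i\<in>S. \<Sum>j\<in>S. a i (\<pi> j) * d i (\<pi> j))"
    by (intro sum.cong refl sum.permute[OF \<pi>, unfolded o_def])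
  also have "\<dots> \<le> (\<Sum>i\<in>S. \<Sum>j\<in>S. (p i + q j) * d i (\<pi> j))"
    using p d in_S by (intro sum_mono mult_right_mono) (auto simp: q_def algebra_simps)
  also have "\<dots> = (\<Sum>i\<in>S. p i * (\<Sum>j\<in>S. d i (\<pi> j))) + (\<Sum>j\<in>S. q j * (\<Sum>i\<in>S. d i (\<pi> j)))"
    by (simp add: distrib_right sum.distrib sum_distrib_left sum.swap[of "\<lambda>i j. q j * d i (\<pi> j)"])
  also have "(\<Sum>i\<in>S. p i * (\<Sum>j\<in>S. d i (\<pi> j))) = (\<Sum>i\<in>S. p i * s)"
    using row sum.permute[OF \<pi>, of "d _", unfolded o_def, symmetric] by (intro sum.cong) simp_all
  also have "(\<Sum>j\<in>S. q j * (\<Sum>i\<in>S. d i (\<pi> j))) = (\<Sum>j\<in>S. q j * s)"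
    using col in_S by (intro sum.cong) auto
  also have "(\<Sum>i\<in>S. p i * s) + (\<Sum>j\<in>S. q j * s) = s * (\<Sum>i\<in>S. a i (\<pi> i))"
    by (simp add: q_def sum_subtractf left_diff_distrib flip: sum_distrib_right)
  finally show ?thesis .
qed

section \<open>Distribution functions of copulas\<close>

definition clamp01 :: "real \<Rightarrow> real" where
  "clamp01 x = max 0 (min 1 x)"

lemma clamp01_in: "clamp01 x \<in> {0..1}"
  by (auto simp: clamp01_def)

lemma clamp01_mono: "x \<le> y \<Longrightarrow> clamp01 x \<le> clamp01 y"
  by (auto simp: clamp01_def)

lemma clamp01_diff_le: "x \<le> y \<Longrightarrow> clamp01 y - clamp01 x \<le> y - x"
  by (auto simp: clamp01_def)

lemma clamp01_id: "x \<in> {0..1} \<Longrightarrow> clamp01 x = x"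
  by (auto simp: clamp01_def)

text \<open>The copula composed with the projection of the plane onto the unit square. It is the distribution
  function of the associated measure, and being monotone and continuous on the whole line in each
  argument it can be fed to \<open>interval_measure\<close>.\<close>
definition copula_cdf :: "(real \<Rightarrow> real \<Rightarrow> real) \<Rightarrow> real \<Rightarrow> real \<Rightarrow> real" where
  "copula_cdf C x y = C (clamp01 x) (clamp01 y)"

lemma copula_cdf_eq: "x \<in> {0..1} \<Longrightarrow> y \<in> {0..1} \<Longrightarrow> copula_cdf C x y = C x y"
  by (simp add: copula_cdf_def clamp01_id)

lemma copula_flip: "C \<in> copulas \<Longrightarrow> (\<lambda>x y. C y x) \<in> copulas"
  unfolding copulas_def by (auto simp: algebra_simps)

lemma copula_cdf_flip: "copula_cdf (\<lambda>x y. C y x) x y = copula_cdf C y x"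
  by (simp add: copula_cdf_def)

lemma copula_cdf_nonneg: "C \<in> copulas \<Longrightarrow> 0 \<le> copula_cdf C x y"
  unfolding copulas_def copula_cdf_def using clamp01_in by simp

lemma copula_cdf_0: "C \<in> copulas \<Longrightarrow> x \<le> 0 \<or> y \<le> 0 \<Longrightarrow> copula_cdf C x y = 0"
proof -
  assume C: "C \<in> copulas" and "x \<le> 0 \<or> y \<le> 0"
  then have "clamp01 x = 0 \<or> clamp01 y = 0" by (auto simp: clamp01_def)
  with C clamp01_in[of x] clamp01_in[of y] show ?thesis
    unfolding copulas_def copula_cdf_def by auto
qed

lemma copula_cdf_1: "C \<in> copulas \<Longrightarrow> 1 \<le> y \<Longrightarrow> copula_cdf C x y = clamp01 x"
proof -
  assume C: "C \<in> copulas" and "1 \<le> y"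
  then have "clamp01 y = 1" by (simp add: clamp01_def)
  with C clamp01_in[of x] show ?thesis unfolding copulas_def copula_cdf_def by simp
qed

text \<open>The rectangle inequality, read as: increments in the first argument grow with the second
  argument. Taking the boundary values for one of the two levels gives monotonicity and the
  1-Lipschitz property.\<close>
lemma copula_cdf_rectangle:
  assumes "C \<in> copulas" "x \<le> x'" "y \<le> y'"
  shows "copula_cdf C x' y - copula_cdf C x y \<le> copula_cdf C x' y' - copula_cdf C x y'"
proof -
  have "0 \<le> C (clamp01 x') (clamp01 y') - C (clamp01 x') (clamp01 y)
      - C (clamp01 x) (clamp01 y') + C (clamp01 x) (clamp01 y)"
    using assms clamp01_in[of x] clamp01_in[of x'] clamp01_in[of y] clamp01_in[of y']
      clamp01_mono[of x x'] clamp01_mono[of y y'] unfolding copulas_def by simp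
  then show ?thesis by (simp add: copula_cdf_def)
qed

lemma copula_cdf_mono: "C \<in> copulas \<Longrightarrow> x \<le> x' \<Longrightarrow> copula_cdf C x y \<le> copula_cdf C x' y"
  using copula_cdf_rectangle[of C x x' "min 0 y" y]
    copula_cdf_0[of C x "min 0 y"] copula_cdf_0[of C x' "min 0 y"] by linarith

lemma copula_cdf_diff_le:
  "C \<in> copulas \<Longrightarrow> x \<le> x' \<Longrightarrow> copula_cdf C x' y - copula_cdf C x y \<le> x' - x"
  using copula_cdf_rectangle[of C x x' y "max 1 y"] clamp01_diff_le[of x x']
    copula_cdf_1[of C "max 1 y" x] copula_cdf_1[of C "max 1 y" x'] by linarith

lemma copula_cdf_mono2: "C \<in> copulas \<Longrightarrow> y \<le> y' \<Longrightarrow> copula_cdf C x y \<le> copula_cdf C x y'"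
  using copula_cdf_mono[OF copula_flip[of C], of y y' x] by (simp only: copula_cdf_flip[of C])

lemma copula_cdf_diff_le2:
  "C \<in> copulas \<Longrightarrow> y \<le> y' \<Longrightarrow> copula_cdf C x y' - copula_cdf C x y \<le> y' - y"
  using copula_cdf_diff_le[OF copula_flip[of C], of y y' x] by (simp only: copula_cdf_flip[of C])

lemma copula_cdf_continuous: "C \<in> copulas \<Longrightarrow> continuous_on UNIV (\<lambda>x. copula_cdf C x y)"
  by (rule lipschitz_on_continuous_on[of 1], rule lipschitz_onI)
    (smt (verit) copula_cdf_diff_le copula_cdf_mono dist_real_def, simp)

section \<open>Partial derivatives of a copula as densities\<close>

lemma continuous_at_right_UNIV:
  fixes F :: "real \<Rightarrow> real"
  shows "continuous_on UNIV F \<Longrightarrow> continuous (at_right a) F"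
  by (metis UNIV_I continuous_at_imp_continuous_at_within continuous_on_eq_continuous_within)

text \<open>If the increments of \<open>G\<close> dominate those of \<open>F\<close>, then \<open>G - F\<close> is itself the
  distribution function of a measure, and adding it to the measure of \<open>F\<close> gives the measure of
  \<open>G\<close>, because the two agree on half-open intervals.\<close>
lemma emeasure_interval_measure_mono:
  fixes F G :: "real \<Rightarrow> real"
  assumes F: "mono F" "continuous_on UNIV F"
    and G: "continuous_on UNIV G"
    and diff: "mono (\<lambda>x. G x - F x)"
    and A: "A \<in> sets borel"
  shows "emeasure (interval_measure F) A \<le> emeasure (interval_measure G) A"
proof -
  define D where "D x = G x - F x" for x
  define N where "N = measure_of UNIV (sets borel)
    (\<lambda>B. emeasure (interval_measure F) B + emeasure (interval_measure D) B)"
  have D: "mono D" "continuous_on UNIV D"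
    using diff F G by (auto simp: D_def[abs_def] intro: continuous_intros)
  have "mono G"
    using monoD[OF F(1)] monoD[OF D(1)] unfolding D_def mono_def by (smt (verit))
  have sets_N: "sets N = sets borel"
    unfolding N_def by (metis sets.sigma_sets_eq sets_measure_of sets.space_closed space_borel)
  have N: "emeasure N B = emeasure (interval_measure F) B + emeasure (interval_measure D) B"
    if "B \<in> sets borel" for B
  proof (rule emeasure_measure_of[OF N_def])
    show "countably_additive (sets N)
      (\<lambda>B. emeasure (interval_measure F) B + emeasure (interval_measure D) B)"
      unfolding countably_additive_def sets_N
      by (auto simp: suminf_add[symmetric] suminf_emeasure)
  qed (use that sets_N in \<open>auto simp: positive_def\<close>)
  have Ioc: "emeasure (interval_measure H) {a<..b} = ennreal (H b - H a)"
    if "mono H" "continuous_on UNIV H" "a \<le> b" for H :: "real \<Rightarrow> real" and a b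
    using that by (intro emeasure_interval_measure_Ioc) (auto simp: monoD continuous_at_right_UNIV)
  have "N = interval_measure G"
  proof (rule measure_eqI_generator_eq[where \<Omega> = UNIV and E = "range (\<lambda>(a, b). {a<..b::real})"])
    fix X assume "X \<in> range (\<lambda>(a, b). {a<..b::real})"
    then obtain a b where X: "X = {a<..b}" by auto
    show "emeasure N X = emeasure (interval_measure G) X"
    proof (cases "a \<le> b")
      case True
      have "emeasure N X = ennreal (F b - F a) + ennreal (D b - D a)"
        unfolding X using True F D by (simp add: N Ioc)
      also have "\<dots> = ennreal (G b - G a)"
        using True monoD[OF F(1)] monoD[OF D(1)]
        by (subst ennreal_plus[symmetric]) (auto simp: D_def)
      finally show ?thesis unfolding X using True \<open>mono G\<close> G by (simp add: Ioc)
    qed (simp add: X)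
  next
    show "(\<Union>i. {- real (i::nat)<..real i}) = UNIV" by (rule UN_Ioc_eq_UNIV)
    show "emeasure N {- real i<..real i} \<noteq> \<infinity>" for i
      using F D by (simp add: N Ioc)
  qed (auto simp: sets_N borel_sigma_sets_Ioc Int_stable_def)
  then show ?thesis using N[OF A] by auto
qed

lemma AE_le_if_density_le:
  assumes [measurable]: "f \<in> borel_measurable M" "g \<in> borel_measurable M"
    and fin: "(\<integral>\<^sup>+x. f x \<partial>M) \<noteq> \<infinity>"
    and le: "\<And>A. A \<in> sets M \<Longrightarrow> emeasure (density M f) A \<le> emeasure (density M g) A"
  shows "AE x in M. f x \<le> g x"
proof (rule ccontr)
  assume "\<not> (AE x in M. f x \<le> g x)"
  define A where "A = {x \<in> space M. g x < f x}"
  have [measurable]: "A \<in> sets M" unfolding A_def by measurable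
  have "(\<integral>\<^sup>+x. g x * indicator A x \<partial>M) < (\<integral>\<^sup>+x. f x * indicator A x \<partial>M)"
  proof (rule nn_integral_less)
    show "AE x in M. g x * indicator A x \<le> f x * indicator A x"
      by (auto simp: A_def split: split_indicator)
    have "(\<integral>\<^sup>+x. g x * indicator A x \<partial>M) \<le> (\<integral>\<^sup>+x. f x \<partial>M)"
      by (rule nn_integral_mono) (auto simp: A_def split: split_indicator)
    then show "(\<integral>\<^sup>+x. g x * indicator A x \<partial>M) \<noteq> \<infinity>"
      using fin by (auto simp: top_unique)
    show "\<not> (AE x in M. f x * indicator A x \<le> g x * indicator A x)"
    proof
      assume "AE x in M. f x * indicator A x \<le> g x * indicator A x"
      then have "AE x in M. f x \<le> g x"
        using AE_space by eventually_elim (force simp: A_def not_less split: split_indicator_asm)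
      with \<open>\<not> (AE x in M. f x \<le> g x)\<close> show False by blast
    qed
  qed auto
  moreover have "(\<integral>\<^sup>+x. f x * indicator A x \<partial>M) \<le> (\<integral>\<^sup>+x. g x * indicator A x \<partial>M)"
    using le[of A] by (simp add: emeasure_density)
  ultimately show False by (simp add: not_less[symmetric])
qed

text \<open>The number \<open>h q u\<close> plays the role of \<open>\<partial>C/\<partial>x (u, q)\<close>, that is, of the conditional
  probability of \<open>Y \<le> q\<close> given \<open>X = u\<close>. It is the Radon-Nikodym density of the Stieltjes
  measure of \<open>C(_, q)\<close>, which the Lipschitz property bounds by Lebesgue measure. The rectangle
  inequality makes the densities increase with \<open>q\<close>; as this holds only almost everywhere for
  each pair of levels, it is asserted for countably many levels.\<close>
lemma copula_partial_derivative:
  assumes C: "C \<in> copulas"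
  obtains h :: "real \<Rightarrow> real \<Rightarrow> real" where
    "\<And>q. h q \<in> borel_measurable borel"
    "\<And>q u. h q u \<in> {0..1}"
    "\<And>q x. 0 \<le> x \<Longrightarrow> (\<integral>\<^sup>+u\<in>{0..x}. ennreal (h q u) \<partial>lborel) = ennreal (copula_cdf C x q)"
    "AE u in lborel. \<forall>q\<in>\<rat>. \<forall>r\<in>\<rat>. q \<le> r \<longrightarrow> h q u \<le> h r u"
proof -
  define \<mu> where "\<mu> q = interval_measure (\<lambda>x. copula_cdf C x q)" for q
  note cont = copula_cdf_continuous[OF C]
  have mono: "mono (\<lambda>x. copula_cdf C x q)" for q
    by (intro monoI copula_cdf_mono[OF C])
  have \<mu>_Icc: "emeasure (\<mu> q) {a..b} = ennreal (copula_cdf C b q - copula_cdf C a q)" if "a \<le> b" for a b q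
    unfolding \<mu>_def using that by (intro emeasure_interval_measure_Icc cont copula_cdf_mono[OF C])
  have \<mu>_le_lborel: "emeasure (\<mu> q) A \<le> emeasure lborel A" if "A \<in> sets borel" for q A
    unfolding \<mu>_def lborel_eq_real
    using copula_cdf_diff_le[OF C] that
    by (intro emeasure_interval_measure_mono mono cont) (auto intro!: monoI simp: algebra_simps)
  have \<mu>_mono: "emeasure (\<mu> q) A \<le> emeasure (\<mu> r) A" if "A \<in> sets borel" "q \<le> r" for q r A
    unfolding \<mu>_def using copula_cdf_rectangle[OF C _ \<open>q \<le> r\<close>] that(1)
    by (intro emeasure_interval_measure_mono mono cont) (auto intro!: monoI simp: algebra_simps)
  have sets_\<mu>: "sets (\<mu> q) = sets lborel" for q by (simp add: \<mu>_def)
  have "\<exists>f\<in>borel_measurable lborel. density lborel f = \<mu> q" for q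
  proof (rule sigma_finite_measure.Radon_Nikodym[OF sigma_finite_lborel])
    show "absolutely_continuous lborel (\<mu> q)"
      unfolding absolutely_continuous_def null_sets_def
      using \<mu>_le_lborel[of _ q] by (auto simp: sets_\<mu> ) (metis le_zero_eq)
  qed (simp add: \<mu>_def)
  then obtain g where g_borel [measurable]: "\<And>q. g q \<in> borel_measurable lborel"
    and g: "\<And>q. density lborel (g q) = \<mu> q"
    by metis
  \<comment> \<open>The density is at most 1 almost everywhere; truncation makes this true at every point.\<close>
  define h where "h q u = enn2real (min 1 (g q u))" for q u
  show thesis
  proof
    show [measurable]: "h q \<in> borel_measurable borel" for q
      unfolding h_def using g_borel[of q] by measurable
    have h: "ennreal (h q u) = min 1 (g q u)" for q u
      unfolding h_def by (rule ennreal_enn2real) (auto simp: min_less_iff_disj)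
    show "h q u \<in> {0..1}" for q u
    proof -
      have "ennreal (h q u) \<le> 1" unfolding h by simp
      then show ?thesis by (simp add: h_def enn2real_nonneg)
    qed
    have fin: "(\<integral>\<^sup>+u. g q u \<partial>lborel) \<noteq> \<infinity>" for q
    proof -
      have "(\<integral>\<^sup>+u. g q u \<partial>lborel) = emeasure (\<mu> q) UNIV"
        by (simp add: g[symmetric] emeasure_density)
      also have "\<dots> \<le> 1"
      proof -
        have "emeasure (\<mu> q) (\<Union>i. {- real (i::nat)..real i}) = (SUP i. emeasure (\<mu> q) {- real i..real i})"
          by (rule SUP_emeasure_incseq[symmetric]) (auto simp: sets_\<mu> incseq_def)
        also have "\<dots> \<le> 1"
        proof (rule SUP_least)
          fix i :: nat
          have "copula_cdf C (real i) q \<le> 1"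
            using copula_cdf_mono2[OF C, of q "max 1 q" "real i"] clamp01_in[of "real i"]
            by (simp add: copula_cdf_1[OF C])
          then show "emeasure (\<mu> q) {- real i..real i} \<le> 1"
            using copula_cdf_nonneg[OF C, of "- real i" q] by (simp add: \<mu>_Icc)
        qed
        also have "(\<Union>i. {- real (i::nat)..real i}) = UNIV"
        proof (intro set_eqI iffI UNIV_I)
          fix x :: real
          obtain i :: nat where "\<bar>x\<bar> \<le> real i" using real_arch_simple by blast
          then show "x \<in> (\<Union>i. {- real (i::nat)..real i})"
            by (intro UN_I[of i]) (auto simp: abs_le_iff)
        qed
        finally show ?thesis .
      qed
      finally show ?thesis by (auto simp: top_unique)
    qed
    have g_le_1: "AE u in lborel. g q u \<le> 1" for q
      using \<mu>_le_lborel[of _ q] by (intro AE_le_if_density_le fin) (auto simp: g density_1)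
    show "(\<integral>\<^sup>+u\<in>{0..x}. ennreal (h q u) \<partial>lborel) = ennreal (copula_cdf C x q)" if "0 \<le> x" for q x
    proof -
      have "(\<integral>\<^sup>+u\<in>{0..x}. ennreal (h q u) \<partial>lborel) = (\<integral>\<^sup>+u\<in>{0..x}. g q u \<partial>lborel)"
        unfolding h using g_le_1[of q]
        by (intro nn_integral_cong_AE) (auto simp: min_absorb2)
      also have "\<dots> = emeasure (\<mu> q) {0..x}"
        by (simp add: g[symmetric] emeasure_density)
      finally show ?thesis using that by (simp add: \<mu>_Icc copula_cdf_0[OF C])
    qed
    have "AE u in lborel. g q u \<le> g r u" if "q \<le> r" for q r
      using \<mu>_mono[OF _ that] by (intro AE_le_if_density_le fin) (auto simp: g)
    then have "AE u in lborel. \<forall>q\<in>\<rat>. \<forall>r\<in>\<rat>. q \<le> r \<longrightarrow> g q u \<le> g r u"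
      by (intro AE_ball_countable' countable_rat) auto
    then show "AE u in lborel. \<forall>q\<in>\<rat>. \<forall>r\<in>\<rat>. q \<le> r \<longrightarrow> h q u \<le> h r u"
      unfolding h_def by eventually_elim (auto intro!: enn2real_mono min.mono simp: min_less_iff_disj)
  qed
qed

section \<open>The measure of a copula\<close>

text \<open>Conditional quantile construction. Draw \<open>u\<close> and \<open>v\<close> independently and uniformly from
  the unit interval, and let \<open>Y\<close> be the infimum of the rational levels \<open>q\<close> at which the conditional
  distribution function \<open>h q u\<close> reaches \<open>v\<close>. The law of \<open>(u, Y)\<close> is the measure
  sought: for rational \<open>q < y < r\<close> close to \<open>y\<close>, the event \<open>Y \<le> y\<close> lies, up to a null set, between
  \<open>v \<le> h q u\<close> and \<open>v \<le> h r u\<close>, so that the probability of \<open>u \<le> x\<close> and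
  \<open>Y \<le> y\<close> lies between the values of \<open>copula_cdf C x\<close> at \<open>q\<close> and at \<open>r\<close>. As \<open>q\<close> and
  \<open>r\<close> tend to \<open>y\<close>, continuity gives equality.\<close>
lemma copula_measure_exists:
  assumes C: "C \<in> copulas"
  shows "\<exists>M. prob_space M \<and> sets M = sets borel \<and>
    (\<forall>x\<in>{0..1}. \<forall>y\<in>{0..1}. measure M ({..x} \<times> {..y}) = C x y)"
proof -
  obtain h :: "real \<Rightarrow> real \<Rightarrow> real" where
    h_borel [measurable]: "\<And>q. h q \<in> borel_measurable borel"
    and h_in: "\<And>q u. h q u \<in> {0..1}"
    and h_int: "\<And>q x. 0 \<le> x \<Longrightarrow> (\<integral>\<^sup>+u\<in>{0..x}. ennreal (h q u) \<partial>lborel) = ennreal (copula_cdf C x q)"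
    and h_mono: "AE u in lborel. \<forall>q\<in>\<rat>. \<forall>r\<in>\<rat>. q \<le> r \<longrightarrow> h q u \<le> h r u"
    using copula_partial_derivative[OF C] by blast
  define U where "U = uniform_measure lborel {0..1::real}"
  define P where "P = U \<Otimes>\<^sub>M U"
  interpret U: prob_space U unfolding U_def by (intro prob_space_uniform_measure) auto
  interpret UU: pair_prob_space U U ..
  have [measurable_cong]: "sets U = sets borel" and space_U: "space U = UNIV"
    by (simp_all add: U_def)
  have [measurable_cong]: "sets P = sets (borel \<Otimes>\<^sub>M borel)"
    unfolding P_def by (intro sets_pair_measure_cong) (simp_all add: U_def)
  have space_P: "space P = UNIV" by (simp add: P_def space_pair_measure space_U)
  interpret P: prob_space P unfolding P_def by (rule UU.P.prob_space_axioms)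
  \<comment> \<open>Levels reach beyond \<open>[0, 1]\<close> on both sides, so that every \<open>y\<close> in the unit interval has
    levels strictly below and strictly above it. The top level 2 is always admitted in the infimum:
    otherwise the infimum might be over the empty set.\<close>
  define D where "D = \<rat> \<inter> {-1..2::real}"
  have "countable D" unfolding D_def using countable_rat by blast
  define Y where "Y w = Inf {q \<in> D. q = 2 \<or> snd w \<le> h q (fst w)}" for w
  have bdd: "bdd_below {q \<in> D. q = 2 \<or> snd w \<le> h q (fst w)}" for w
    by (rule bdd_belowI[of _ "-1"]) (auto simp: D_def)
  have ne: "{q \<in> D. q = 2 \<or> snd w \<le> h q (fst w)} \<noteq> {}" for w
    by (auto simp: D_def intro: exI[of _ 2])
  have Y_less: "Y w < y \<longleftrightarrow> (\<exists>q\<in>D. q < y \<and> (q = 2 \<or> snd w \<le> h q (fst w)))" for w y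
    unfolding Y_def using cInf_less_iff[OF ne bdd, of w y] by auto
  have Y_le: "Y w \<le> q" if "q \<in> D" "snd w \<le> h q (fst w)" for q w
    unfolding Y_def using that by (intro cInf_lower bdd) auto
  have Y_borel [measurable]: "Y \<in> borel_measurable P"
  proof (rule borel_measurableI_less)
    fix y
    have "{w \<in> space P. Y w < y} =
        (\<Union>q\<in>D \<inter> {..<y}. {w \<in> space P. q = 2 \<or> snd w \<le> h q (fst w)})"
      by (auto simp: Y_less)
    also have "\<dots> \<in> sets P"
      using \<open>countable D\<close> by (intro sets.countable_UN') auto
    finally show "{w \<in> space P. Y w < y} \<in> sets P" .
  qed
  define E where "E q x = {w \<in> space P. fst w \<le> x \<and> snd w \<le> h q (fst w)}" for q x
  have E_sets [measurable]: "E q x \<in> sets P" for q x unfolding E_def by measurable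
  have prob_E: "P.prob (E q x) = copula_cdf C x q" if x: "x \<in> {0..1}" for q x
  proof -
    have "emeasure P (E q x) = (\<integral>\<^sup>+u. emeasure U (Pair u -` E q x) \<partial>U)"
      unfolding P_def by (rule U.emeasure_pair_measure_alt[OF E_sets[unfolded P_def]])
    also have "\<dots> = (\<integral>\<^sup>+u. indicator {..x} u * ennreal (h q u) \<partial>U)"
    proof (intro nn_integral_cong)
      fix u
      have "{0..1} \<inter> {..h q u} = {0..h q u}" using h_in[of q u] by auto
      then show "emeasure U (Pair u -` E q x) = indicator {..x} u * ennreal (h q u)"
        using h_in[of q u]
        by (auto simp: E_def space_P U_def vimage_def atMost_def[symmetric] divide_ennreal_def
            split: split_indicator)
    qed
    also have "\<dots> = (\<integral>\<^sup>+u. indicator {..x} u * ennreal (h q u) * indicator {0..1} u \<partial>lborel)"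
      unfolding U_def by (subst nn_integral_uniform_measure) (auto simp: divide_ennreal_def)
    also have "\<dots> = (\<integral>\<^sup>+u\<in>{0..x}. ennreal (h q u) \<partial>lborel)"
      using x by (intro nn_integral_cong) (auto split: split_indicator)
    finally show ?thesis
      using x h_int copula_cdf_nonneg[OF C] by (simp add: measure_def)
  qed
  have h_mono_P: "AE w in P. \<forall>q\<in>\<rat>. \<forall>r\<in>\<rat>. q \<le> r \<longrightarrow> h q (fst w) \<le> h r (fst w)"
  proof (rule AE_distrD[where M' = U and f = fst])
    show "AE u in distr P U fst. \<forall>q\<in>\<rat>. \<forall>r\<in>\<rat>. q \<le> r \<longrightarrow> h q u \<le> h r u"
      unfolding P_def U.distr_pair_fst unfolding U_def
      by (rule AE_uniform_measureI) (use h_mono in auto)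
  qed (simp add: P_def)
  define M where "M = distr P borel (\<lambda>w. (fst w, Y w))"
  have meas [measurable]: "(\<lambda>w. (fst w, Y w)) \<in> P \<rightarrow>\<^sub>M borel"
    unfolding borel_prod[symmetric] by measurable
  have "prob_space M" unfolding M_def by (rule P.prob_space_distr[OF meas])
  moreover have "sets M = sets borel" by (simp add: M_def)
  moreover have "measure M ({..x} \<times> {..y}) = C x y" if x: "x \<in> {0..1}" and y: "y \<in> {0..1}" for x y
  proof -
    define p where "p = P.prob {w \<in> space P. fst w \<le> x \<and> Y w \<le> y}"
    have "measure M ({..x} \<times> {..y}) = p"
      unfolding M_def p_def
      by (subst measure_distr[OF meas]) (auto intro!: arg_cong[where f = P.prob] borel_closed closed_Times)
    moreover have "p = copula_cdf C x y"
    proof (rule antisym; rule field_le_epsilon)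
      fix e :: real assume "0 < e"
      then obtain q where q: "q \<in> \<rat>" "y - min 1 e < q" "q < y"
        using Rats_dense_in_real[of "y - min 1 e" y] by auto
      then have "q \<in> D" using y by (auto simp: D_def)
      then have "P.prob (E q x) \<le> p"
        unfolding p_def E_def using q Y_le by (intro P.finite_measure_mono) fastforce+
      then show "copula_cdf C x y \<le> p + e"
        using prob_E[OF x, of q] copula_cdf_diff_le2[OF C, of q y x] q by auto
    next
      fix e :: real assume "0 < e"
      then obtain r where r: "r \<in> \<rat>" "y < r" "r < y + min 1 e"
        using Rats_dense_in_real[of y "y + min 1 e"] by auto
      have "p \<le> P.prob (E r x)"
        unfolding p_def
      proof (rule P.finite_measure_mono_AE)
        show "AE w in P. w \<in> {w \<in> space P. fst w \<le> x \<and> Y w \<le> y} \<longrightarrow> w \<in> E r x"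
          using h_mono_P
        proof eventually_elim
          case (elim w)
          show ?case
          proof
            assume w: "w \<in> {w \<in> space P. fst w \<le> x \<and> Y w \<le> y}"
            then have "Y w < r" using r by auto
            then obtain q where "q \<in> D" "q < r" "q = 2 \<or> snd w \<le> h q (fst w)"
              using Y_less by blast
            then have "snd w \<le> h r (fst w)"
              using elim r y by (auto simp: D_def intro: order_trans)
            then show "w \<in> E r x" using w by (simp add: E_def)
          qed
        qed
      qed simp
      then show "p \<le> copula_cdf C x y + e"
        using prob_E[OF x, of r] copula_cdf_diff_le2[OF C, of y r x] r by auto
    qed
    ultimately show ?thesis using x y by (simp add: copula_cdf_eq)
  qed
  ultimately show ?thesis by blast
qed

lemma atMost_prod: "{..(a :: real \<times> real)} = {..fst a} \<times> {..snd a}"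
  by (auto simp: less_eq_prod_def)

text \<open>The mass of the unit square is 1, and so the prescribed values determine the measure of
  every lower left quadrant of the plane; these quadrants form a generator of the Borel sets that is
  closed under intersection.\<close>
lemma copula_measure_unique:
  assumes C: "C \<in> copulas"
    and "prob_space M" and sets_M: "sets M = sets borel"
    and M: "\<And>x y. x \<in> {0..1} \<Longrightarrow> y \<in> {0..1} \<Longrightarrow> measure M ({..x} \<times> {..y}) = C x y"
    and "prob_space N" and sets_N: "sets N = sets borel"
    and N: "\<And>x y. x \<in> {0..1} \<Longrightarrow> y \<in> {0..1} \<Longrightarrow> measure N ({..x} \<times> {..y}) = C x y"
  shows "M = N"
proof -
  have cdf: "measure L ({..x} \<times> {..y}) = copula_cdf C x y"
    if "prob_space L" and sets_L: "sets L = sets borel"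
      and L: "\<And>x y. x \<in> {0..1} \<Longrightarrow> y \<in> {0..1} \<Longrightarrow> measure L ({..x} \<times> {..y}) = C x y" for L x y
  proof -
    interpret L: prob_space L by fact
    have [simp]: "{..s} \<times> {..t} \<in> L.events" for s t :: real
      unfolding sets_L by (intro borel_closed closed_Times) auto
    have L': "L.prob ({..clamp01 s} \<times> {..clamp01 t}) = copula_cdf C s t" for s t
      unfolding copula_cdf_def by (rule L[OF clamp01_in clamp01_in])
    have "L.prob ({..1} \<times> {..1}) = 1"
      using L'[of 1 1] copula_cdf_1[OF C, of 1 1] by (simp add: clamp01_def)
    then have unit: "AE w in L. w \<in> {..1} \<times> {..1}"
      by (subst L.AE_in_set_eq_1) auto
    show ?thesis
    proof (cases "x < 0 \<or> y < 0")
      case True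
      have "L.prob ({..x} \<times> {..y}) \<le> L.prob ({..clamp01 x} \<times> {..clamp01 y})"
        using unit by (intro L.finite_measure_mono_AE) (auto simp: clamp01_def)
      also have "\<dots> = 0" using True copula_cdf_0[OF C, of x y] by (auto simp: L')
      finally show ?thesis
        using True copula_cdf_0[OF C, of x y] by (auto simp: measure_le_0_iff)
    next
      case False
      then have "L.prob ({..x} \<times> {..y}) = L.prob ({..clamp01 x} \<times> {..clamp01 y})"
        using unit by (intro L.finite_measure_eq_AE) (auto simp: clamp01_def)
      with L' show ?thesis by simp
    qed
  qed
  interpret M: prob_space M by fact
  interpret N: prob_space N by fact
  show ?thesis
  proof (rule measure_eqI_generator_eq[where \<Omega> = UNIV and E = "range (\<lambda>a :: real \<times> real. {..a})"])
    show "Int_stable (range (\<lambda>a :: real \<times> real. {..a}))"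
      unfolding Int_stable_def
    proof safe
      fix a b :: "real \<times> real"
      have "{..a} \<inter> {..b} = {..inf a b}" by auto
      then show "{..a} \<inter> {..b} \<in> range atMost" by blast
    qed
    show "emeasure M X = emeasure N X" if "X \<in> range (\<lambda>a :: real \<times> real. {..a})" for X
    proof -
      from that obtain a where X: "X = {..fst a} \<times> {..snd a}"
        using atMost_prod by auto
      show ?thesis
        unfolding X M.emeasure_eq_measure N.emeasure_eq_measure
        by (simp only: cdf[OF \<open>prob_space M\<close> sets_M M] cdf[OF \<open>prob_space N\<close> sets_N N])
    qed
    have "sets (borel :: (real \<times> real) measure) = sigma_sets UNIV (range (\<lambda>a. {..a}))"
      by (subst borel_eq_atMost) (rule sets_measure_of, simp)
    then show "sets M = sigma_sets UNIV (range (\<lambda>a. {..a}))"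
      "sets N = sigma_sets UNIV (range (\<lambda>a. {..a}))"
      using sets_M sets_N by simp_all
    show "(\<Union>i. {..(real i, real i)}) = UNIV"
    proof (intro set_eqI iffI UNIV_I)
      fix w :: "real \<times> real"
      obtain i :: nat where "max (fst w) (snd w) \<le> real i" using real_arch_simple by blast
      then show "w \<in> (\<Union>i. {..(real i, real i)})" by (auto simp: atMost_prod intro: UN_I[of i] simp: mem_Times_iff)
    qed
  qed auto
qed

lemma copula_measure:
  assumes C: "C \<in> copulas"
  shows "prob_space (copula_measure C)" "sets (copula_measure C) = sets borel"
    "\<And>x y. x \<in> {0..1} \<Longrightarrow> y \<in> {0..1} \<Longrightarrow> measure (copula_measure C) ({..x} \<times> {..y}) = C x y"
proof -
  define Q where "Q M \<longleftrightarrow> prob_space M \<and> sets M = sets borel \<and>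
    (\<forall>x\<in>{0..1}. \<forall>y\<in>{0..1}. measure M ({..x} \<times> {..y}) = C x y)" for M
  have "\<exists>M. Q M" unfolding Q_def by (rule copula_measure_exists[OF C])
  moreover have "M = N" if "Q M" "Q N" for M N
    by (rule copula_measure_unique[OF C]) (use that in \<open>simp_all add: Q_def\<close>)
  ultimately have "Q (THE M. Q M)" by (metis theI)
  then have "Q (copula_measure C)" by (simp add: copula_measure_def Q_def)
  then show "prob_space (copula_measure C)" "sets (copula_measure C) = sets borel"
    "\<And>x y. x \<in> {0..1} \<Longrightarrow> y \<in> {0..1} \<Longrightarrow> measure (copula_measure C) ({..x} \<times> {..y}) = C x y"
    by (simp_all add: Q_def)
qed

text \<open>Because the distribution function is continuous, the endpoints of the interval carry no
  mass.\<close>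
lemma (in prob_space) prob_atLeastLessThan_if_uniform_cdf:
  fixes X :: "'a \<Rightarrow> real"
  assumes [measurable]: "X \<in> borel_measurable M"
    and cdf: "\<And>x. x \<in> {0..1} \<Longrightarrow> prob {w \<in> space M. X w \<le> x} = x"
    and "0 \<le> s" "s \<le> t" "t \<le> 1"
  shows "prob {w \<in> space M. s \<le> X w \<and> X w < t} = t - s"
proof -
  have less: "prob {w \<in> space M. X w < x} = x" if x: "x \<in> {0..1}" for x
  proof (rule antisym)
    have "prob {w \<in> space M. X w < x} \<le> prob {w \<in> space M. X w \<le> x}"
      by (rule finite_measure_mono) auto
    then show "prob {w \<in> space M. X w < x} \<le> x" using cdf[OF x] by simp
    show "x \<le> prob {w \<in> space M. X w < x}"
    proof (rule field_le_epsilon)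
      fix e :: real assume "0 < e"
      show "x \<le> prob {w \<in> space M. X w < x} + e"
      proof (cases "x \<le> e")
        case True
        then show ?thesis using measure_nonneg[of M "{w \<in> space M. X w < x}"] by linarith
      next
        case False
        have "prob {w \<in> space M. X w \<le> x - e} \<le> prob {w \<in> space M. X w < x}"
          using \<open>0 < e\<close> by (intro finite_measure_mono) auto
        with cdf[of "x - e"] False x \<open>0 < e\<close> show ?thesis by simp
      qed
    qed
  qed
  have "{w \<in> space M. s \<le> X w \<and> X w < t} = {w \<in> space M. X w < t} - {w \<in> space M. X w < s}"
    by auto
  also have "prob \<dots> = prob {w \<in> space M. X w < t} - prob {w \<in> space M. X w < s}"
    using \<open>s \<le> t\<close> by (intro finite_measure_Diff) auto
  finally show ?thesis using less assms(3-5) by simp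
qed

text \<open>Both marginals are uniform. The half-open unit square has full measure because uniform
  marginals charge neither endpoint.\<close>
lemma copula_measure_marginals:
  assumes C: "C \<in> copulas" and "0 \<le> s" "s \<le> t" "t \<le> 1"
  shows "measure (copula_measure C) ({s..<t} \<times> {0..<1}) = t - s"
    and "measure (copula_measure C) ({0..<1} \<times> {s..<t}) = t - s"
proof -
  define M where "M = copula_measure C"
  interpret M: prob_space M unfolding M_def by (rule copula_measure(1)[OF C])
  have [measurable_cong]: "sets M = sets (borel \<Otimes>\<^sub>M borel)"
    unfolding M_def copula_measure(2)[OF C] borel_prod[symmetric] ..
  have space_M: "space M = UNIV"
    using sets_eq_imp_space_eq[OF copula_measure(2)[OF C]] by (simp add: M_def)
  have C_bound: "C x 1 = x" "C 1 x = x" if "x \<in> {0..1}" for x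
    using C that by (auto simp: copulas_def)
  have cdf: "M.prob ({..x} \<times> {..y}) = C x y" if "x \<in> {0..1}" "y \<in> {0..1}" for x y
    unfolding M_def using that by (rule copula_measure(3)[OF C])
  have [measurable]: "A \<times> B \<in> M.events" if "A \<in> sets borel" "B \<in> sets borel" for A B :: "real set"
    using that by measurable
  have strips: "{w. fst w \<le> x} \<in> M.events" "{w. snd w \<le> x} \<in> M.events"
    "{w. a \<le> fst w \<and> fst w < b} \<in> M.events" "{w. a \<le> snd w \<and> snd w < b} \<in> M.events"
    for x a b
  proof -
    have "{w \<in> space M. fst w \<le> x} \<in> M.events" "{w \<in> space M. snd w \<le> x} \<in> M.events"
      "{w \<in> space M. a \<le> fst w \<and> fst w < b} \<in> M.events"
      "{w \<in> space M. a \<le> snd w \<and> snd w < b} \<in> M.events"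
      by measurable
    then show "{w. fst w \<le> x} \<in> M.events" "{w. snd w \<le> x} \<in> M.events"
      "{w. a \<le> fst w \<and> fst w < b} \<in> M.events" "{w. a \<le> snd w \<and> snd w < b} \<in> M.events"
      by (simp_all add: space_M)
  qed
  have unit: "AE w in M. w \<in> {..1} \<times> {..1}"
    using cdf[of 1 1] C_bound[of 1] by (subst M.AE_in_set_eq_1) auto
  have fst_cdf: "M.prob {w \<in> space M. fst w \<le> x} = x" if x: "x \<in> {0..1}" for x
  proof -
    have "M.prob {w \<in> space M. fst w \<le> x} = M.prob ({..x} \<times> {..1})"
      using unit by (intro M.finite_measure_eq_AE) (auto simp: space_M strips)
    then show ?thesis using cdf[OF x, of 1] C_bound[OF x] by simp
  qed
  have snd_cdf: "M.prob {w \<in> space M. snd w \<le> x} = x" if x: "x \<in> {0..1}" for x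
  proof -
    have "M.prob {w \<in> space M. snd w \<le> x} = M.prob ({..1} \<times> {..x})"
      using unit by (intro M.finite_measure_eq_AE) (auto simp: space_M strips)
    then show ?thesis using cdf[OF _ x, of 1] C_bound[OF x] by simp
  qed
  have fst_prob: "M.prob {w \<in> space M. a \<le> fst w \<and> fst w < b} = b - a" if "0 \<le> a" "a \<le> b" "b \<le> 1" for a b
    using that by (intro M.prob_atLeastLessThan_if_uniform_cdf fst_cdf) auto
  have snd_prob: "M.prob {w \<in> space M. a \<le> snd w \<and> snd w < b} = b - a" if "0 \<le> a" "a \<le> b" "b \<le> 1" for a b
    using that by (intro M.prob_atLeastLessThan_if_uniform_cdf snd_cdf) auto
  have "AE w in M. 0 \<le> fst w \<and> fst w < 1"
    using fst_prob[of 0 1] by (intro iffD1[OF M.prob_Collect_eq_1]) auto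
  moreover have "AE w in M. 0 \<le> snd w \<and> snd w < 1"
    using snd_prob[of 0 1] by (intro iffD1[OF M.prob_Collect_eq_1]) auto
  ultimately have half_open: "AE w in M. w \<in> {0..<1} \<times> {0..<1}"
    by eventually_elim (auto simp: mem_Times_iff)
  have "M.prob ({s..<t} \<times> {0..<1}) = M.prob {w \<in> space M. s \<le> fst w \<and> fst w < t}"
    using half_open by (intro M.finite_measure_eq_AE) (auto simp: space_M strips)
  then show "measure (copula_measure C) ({s..<t} \<times> {0..<1}) = t - s"
    using fst_prob assms by (simp add: M_def)
  have "M.prob ({0..<1} \<times> {s..<t}) = M.prob {w \<in> space M. s \<le> snd w \<and> snd w < t}"
    using half_open by (intro M.finite_measure_eq_AE) (auto simp: space_M strips)
  then show "measure (copula_measure C) ({0..<1} \<times> {s..<t}) = t - s"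
    using snd_prob assms by (simp add: M_def)
qed

section \<open>Masses of grid cells\<close>

definition grid_interval :: "nat \<Rightarrow> nat \<Rightarrow> real set" where
  "grid_interval n i = {(real i - 1) / real n..<real i / real n}"

lemma grid_interval_borel [measurable]: "grid_interval n i \<in> sets borel"
  by (simp add: grid_interval_def)

lemma disjoint_grid_intervals: "disjoint_family (grid_interval n)"
  unfolding disjoint_family_on_def
proof (intro ballI impI, rule ccontr)
  fix i j :: nat assume "i \<noteq> j" and "grid_interval n i \<inter> grid_interval n j \<noteq> {}"
  then obtain x where x: "(real i - 1) / real n \<le> x" "x < real i / real n"
    "(real j - 1) / real n \<le> x" "x < real j / real n"
    unfolding grid_interval_def by (metis IntE atLeastLessThan_iff ex_in_conv)
  then have "n \<noteq> 0" by (intro notI) simp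
  then have "real i - 1 \<le> x * real n" "x * real n < real i" "real j - 1 \<le> x * real n" "x * real n < real j"
    using x by (simp_all add: field_simps)
  then have "real i < real (j + 1)" "real j < real (i + 1)" by simp_all
  then have "i < j + 1" "j < i + 1" by linarith+
  with \<open>i \<noteq> j\<close> show False by simp
qed

lemma Union_grid_intervals:
  assumes n: "1 \<le> n"
  shows "(\<Union>i\<in>{1..n}. grid_interval n i) = {0..<1}"
proof (intro equalityI subsetI)
  fix x assume "x \<in> (\<Union>i\<in>{1..n}. grid_interval n i)"
  then obtain i where i: "i \<in> {1..n}" "(real i - 1) / real n \<le> x" "x < real i / real n"
    by (auto simp: grid_interval_def)
  have "0 \<le> (real i - 1) / real n" "real i / real n \<le> 1" using i(1) by auto
  with i(2,3) have "0 \<le> x" "x < 1" by (blast intro: order_trans order_less_le_trans)+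
  then show "x \<in> {0..<1}" by simp
next
  fix x :: real assume x: "x \<in> {0..<1}"
  define k where "k = nat \<lfloor>real n * x\<rfloor>"
  have k: "real k \<le> real n * x" "real n * x < real k + 1"
    using x unfolding k_def by (auto simp: of_nat_nat)
  have "real n * x < real n" using x n by (simp add: mult_less_cancel_left1)
  then have "k < n" using k by linarith
  moreover have "x \<in> grid_interval n (k + 1)"
    using k n by (simp add: grid_interval_def field_simps)
  ultimately show "x \<in> (\<Union>i\<in>{1..n}. grid_interval n i)" by (intro UN_I[of "k + 1"]) auto
qed

definition cell_mass :: "(real \<Rightarrow> real \<Rightarrow> real) \<Rightarrow> nat \<Rightarrow> nat \<Rightarrow> nat \<Rightarrow> real" where
  "cell_mass C n i j = measure (copula_measure C) (grid_interval n i \<times> grid_interval n j)"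

text \<open>Uniform marginals say that the masses of the grid cells, multiplied by \<open>n\<close>, form a doubly
  stochastic matrix.\<close>
lemma cell_mass_sums:
  assumes C: "C \<in> copulas" and n: "1 \<le> n" and k: "k \<in> {1..n}"
  shows "(\<Sum>j\<in>{1..n}. cell_mass C n k j) = 1 / real n"
    and "(\<Sum>i\<in>{1..n}. cell_mass C n i k) = 1 / real n"
proof -
  interpret M: prob_space "copula_measure C" by (rule copula_measure(1)[OF C])
  have ev: "A \<times> B \<in> M.events" if "A \<in> sets borel" "B \<in> sets borel" for A B :: "real set"
    using that by (simp add: copula_measure(2)[OF C] borel_Times)
  have bounds: "0 \<le> (real k - 1) / real n" "(real k - 1) / real n \<le> real k / real n" "real k / real n \<le> 1"
    using k by (auto simp: divide_right_mono)
  have width: "real k / real n - (real k - 1) / real n = 1 / real n"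
    by (simp add: diff_divide_distrib)
  have disjoint: "grid_interval n i \<inter> grid_interval n j = {}" if "i \<noteq> j" for i j
    using disjoint_grid_intervals[of n] that by (auto simp: disjoint_family_on_def)
  have "(\<Sum>j\<in>{1..n}. cell_mass C n k j) =
      M.prob (\<Union>j\<in>{1..n}. grid_interval n k \<times> grid_interval n j)"
    unfolding cell_mass_def
    by (rule M.finite_measure_finite_Union[symmetric])
      (use disjoint in \<open>auto simp: disjoint_family_on_def ev\<close>)
  also have "\<dots> = M.prob (grid_interval n k \<times> {0..<1})"
    unfolding Union_grid_intervals[OF n, symmetric] by (rule arg_cong[where f = M.prob]) auto
  finally show "(\<Sum>j\<in>{1..n}. cell_mass C n k j) = 1 / real n"
    using copula_measure_marginals(1)[OF C bounds] width by (simp add: grid_interval_def)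
  have "(\<Sum>i\<in>{1..n}. cell_mass C n i k) =
      M.prob (\<Union>i\<in>{1..n}. grid_interval n i \<times> grid_interval n k)"
    unfolding cell_mass_def
    by (rule M.finite_measure_finite_Union[symmetric])
      (use disjoint in \<open>auto simp: disjoint_family_on_def ev\<close>)
  also have "\<dots> = M.prob ({0..<1} \<times> grid_interval n k)"
    unfolding Union_grid_intervals[OF n, symmetric] by (rule arg_cong[where f = M.prob]) auto
  finally show "(\<Sum>i\<in>{1..n}. cell_mass C n i k) = 1 / real n"
    using copula_measure_marginals(2)[OF C bounds] width by (simp add: grid_interval_def)
qed

lemma copula_integral_step_function:
  assumes C: "C \<in> copulas" and n: "1 \<le> n"
    and f: "\<And>i j x y. \<lbrakk>i \<in> {1..n}; j \<in> {1..n}; x \<in> grid_interval n i; y \<in> grid_interval n j\<rbrakk>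
      \<Longrightarrow> f (x, y) = a i j"
  shows "copula_integral f C = (\<Sum>i\<in>{1..n}. \<Sum>j\<in>{1..n}. a i j * cell_mass C n i j)"
proof -
  interpret M: prob_space "copula_measure C" by (rule copula_measure(1)[OF C])
  have ev: "grid_interval n i \<times> grid_interval n j \<in> M.events" for i j
    by (simp add: copula_measure(2)[OF C] borel_Times)
  have step: "indicator ({0..<1} \<times> {0..<1}) w *\<^sub>R f w =
      (\<Sum>i\<in>{1..n}. \<Sum>j\<in>{1..n}. a i j * indicator (grid_interval n i \<times> grid_interval n j) w)"
    for w :: "real \<times> real"
  proof (cases "w \<in> {0..<1} \<times> {0..<1}")
    case True
    then obtain i j where i: "i \<in> {1..n}" "fst w \<in> grid_interval n i"
      and j: "j \<in> {1..n}" "snd w \<in> grid_interval n j"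
      using Union_grid_intervals[OF n] by (metis UN_E mem_Times_iff)
    have "fst w \<in> grid_interval n k \<longleftrightarrow> k = i" "snd w \<in> grid_interval n k \<longleftrightarrow> k = j" for k
      using disjoint_grid_intervals[of n] i j by (auto simp: disjoint_family_on_def)
    then have "(\<Sum>i\<in>{1..n}. \<Sum>j\<in>{1..n}. a i j * indicator (grid_interval n i \<times> grid_interval n j) w)
        = (\<Sum>i'\<in>{1..n}. if i' = i then (\<Sum>j'\<in>{1..n}. if j' = j then a i' j' else 0) else 0)"
      by (intro sum.cong refl) (auto simp: indicator_def mem_Times_iff intro!: sum.cong)
    also have "\<dots> = a i j" using i j by simp
    also have "\<dots> = f w" using f[OF i(1) j(1) i(2) j(2)] by simp
    finally show ?thesis using True by simp
  next
    case False
    then have "w \<notin> grid_interval n i \<times> grid_interval n j" if "i \<in> {1..n}" "j \<in> {1..n}" for i j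
      using that Union_grid_intervals[OF n] by (metis UN_I mem_Times_iff)
    with False show ?thesis by (simp add: sum.neutral)
  qed
  define c where "c i j w = a i j * indicator (grid_interval n i \<times> grid_interval n j) w"
    for i j and w :: "real \<times> real"
  have c: "integrable (copula_measure C) (c i j)"
    "integral\<^sup>L (copula_measure C) (c i j) = a i j * cell_mass C n i j" for i j
    using ev[of i j]
    by (auto simp: c_def[abs_def] cell_mass_def integrable_real_indicator M.emeasure_eq_measure)
  have "copula_integral f C = integral\<^sup>L (copula_measure C) (\<lambda>w. \<Sum>i\<in>{1..n}. \<Sum>j\<in>{1..n}. c i j w)"
    unfolding copula_integral_def set_lebesgue_integral_def step c_def ..
  then show ?thesis
    by (simp only: Bochner_Integration.integral_sum Bochner_Integration.integrable_sum c)
qed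

text \<open>All squares have side \<open>1 / n\<close>, so the second partition of the shuffle is the equal one
  too and its squares are cells of the grid.\<close>
lemma cell_mass_shuffle:
  assumes n: "1 \<le> n" and shuffle: "shuffle_of_M n (equal_partition n) \<pi> (\<lambda>i. 1) C"
    and i: "i \<in> {1..n}"
  shows "cell_mass C n i (\<pi> i) = 1 / real n"
proof -
  obtain t where t: "unit_partition n t"
    and square: "\<And>i. i \<in> {1..n} \<Longrightarrow>
      t (\<pi> i) - t (\<pi> i - 1) = equal_partition n i - equal_partition n (i - 1)"
    and mass: "\<And>i B. i \<in> {1..n} \<Longrightarrow> B \<in> sets borel \<Longrightarrow>
      measure (copula_measure C) (B \<inter> ({equal_partition n (i - 1)..<equal_partition n i} \<times> {t (\<pi> i - 1)..<t (\<pi> i)})) =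
      (equal_partition n i - equal_partition n (i - 1)) *
      measure (uniform_segment (equal_partition n (i - 1), t (\<pi> i - 1)) (equal_partition n i, t (\<pi> i))) B"
    and \<pi>: "\<pi> permutes {1..n}"
    using shuffle unfolding shuffle_of_M_def by (auto 0 3)
  have step: "equal_partition n i - equal_partition n (i - 1) = 1 / real n" if "i \<in> {1..n}" for i
    using that by (simp add: equal_partition_def of_nat_diff diff_divide_distrib)
  have t_eq: "t k = real k / real n" if "k \<le> n" for k
    using that
  proof (induction k)
    case 0
    then show ?case using t by (simp add: unit_partition_def)
  next
    case (Suc k)
    then obtain i where "i \<in> {1..n}" "\<pi> i = Suc k"
      using permutes_image[OF \<pi>] by (metis Suc_le_mono atLeastAtMost_iff imageE le0 One_nat_def)
    with square[of i] step[of i] have "t (Suc k) = t k + 1 / real n" by simp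
    with Suc show ?case by (simp add: add_divide_distrib)
  qed
  have \<pi>_i: "\<pi> i \<in> {1..n}" using permutes_in_image[OF \<pi>] i by blast
  define L where "L = uniform_segment (equal_partition n (i - 1), t (\<pi> i - 1)) (equal_partition n i, t (\<pi> i))"
  have "prob_space (uniform_measure lborel {0..1::real})"
    by (intro prob_space_uniform_measure) auto
  then have "prob_space L"
    unfolding L_def uniform_segment_def
    by (rule prob_space.prob_space_distr)
      (auto intro!: borel_measurable_continuous_onI continuous_on_linepath cong: measurable_cong_sets)
  moreover have "space L = UNIV" by (simp add: L_def uniform_segment_def)
  ultimately have "measure L UNIV = 1" using prob_space.prob_space by fastforce
  moreover have "t (\<pi> i) = real (\<pi> i) / real n" "t (\<pi> i - 1) = (real (\<pi> i) - 1) / real n"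
    using \<pi>_i t_eq[of "\<pi> i"] t_eq[of "\<pi> i - 1"] by (auto simp: of_nat_diff)
  then have "grid_interval n i \<times> grid_interval n (\<pi> i) =
      {equal_partition n (i - 1)..<equal_partition n i} \<times> {t (\<pi> i - 1)..<t (\<pi> i)}"
    using i by (simp add: grid_interval_def equal_partition_def of_nat_diff)
  ultimately show ?thesis
    using mass[OF i, of UNIV] step[OF i] by (simp add: cell_mass_def L_def)
qed

text \<open>The cell \<open>(i, \<pi> i)\<close> exhausts the mass \<open>1 / n\<close> of its row, so every other cell in that
  row is null.\<close>
lemma copula_integral_shuffle:
  assumes n: "1 \<le> n" and shuffle: "shuffle_of_M n (equal_partition n) \<pi> (\<lambda>i. 1) C"
    and f: "\<And>i j x y. \<lbrakk>i \<in> {1..n}; j \<in> {1..n}; x \<in> grid_interval n i; y \<in> grid_interval n j\<rbrakk>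
      \<Longrightarrow> f (x, y) = a i j"
  shows "copula_integral f C = 1 / real n * (\<Sum>i\<in>{1..n}. a i (\<pi> i))"
proof -
  have C: "C \<in> copulas" and \<pi>: "\<pi> permutes {1..n}"
    using shuffle by (auto simp: shuffle_of_M_def)
  have row: "(\<Sum>j\<in>{1..n}. a i j * cell_mass C n i j) = a i (\<pi> i) * (1 / real n)"
    if i: "i \<in> {1..n}" for i
  proof -
    have \<pi>_i: "\<pi> i \<in> {1..n}" using permutes_in_image[OF \<pi>] i by blast
    have "(\<Sum>j\<in>{1..n} - {\<pi> i}. cell_mass C n i j) = 0"
      using cell_mass_sums(1)[OF C n i] cell_mass_shuffle[OF n shuffle i] \<pi>_i
      by (simp add: sum_diff1)
    then have "\<forall>j\<in>{1..n} - {\<pi> i}. cell_mass C n i j = 0"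
      by (subst (asm) sum_nonneg_eq_0_iff) (auto simp: cell_mass_def)
    then have "(\<Sum>j\<in>{1..n}. a i j * cell_mass C n i j) = a i (\<pi> i) * cell_mass C n i (\<pi> i)"
      using \<pi>_i by (subst sum.remove[of _ "\<pi> i"]) auto
    then show ?thesis by (simp only: cell_mass_shuffle[OF n shuffle i])
  qed
  have "copula_integral f C = (\<Sum>i\<in>{1..n}. \<Sum>j\<in>{1..n}. a i j * cell_mass C n i j)"
    by (rule copula_integral_step_function[OF C n]) (rule f)
  also have "\<dots> = (\<Sum>i\<in>{1..n}. a i (\<pi> i) * (1 / real n))"
    by (rule sum.cong[OF refl row])
  finally show ?thesis by (simp add: sum_divide_distrib)
qed

section \<open>Optimality of the shuffle\<close>

theorem theorem2p1:
  fixes n :: nat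
    and a :: "nat \<Rightarrow> nat \<Rightarrow> real"
    and f :: "real \<times> real \<Rightarrow> real"
    and \<pi>' :: "nat \<Rightarrow> nat"
    and C_max :: "real \<Rightarrow> real \<Rightarrow> real"
  assumes n: "1 \<le> n"
    and f: "\<And>i j x y. \<lbrakk>i \<in> {1..n}; j \<in> {1..n};
        x \<in> {(real i - 1) / real n..<real i / real n};
        y \<in> {(real j - 1) / real n..<real j / real n}\<rbrakk> \<Longrightarrow> f (x, y) = a i j"
    and opt: "is_arg_max (\<lambda>\<pi>. \<Sum>i=1..n. a i (\<pi> i)) (\<lambda>\<pi>. \<pi> permutes {1..n}) \<pi>'"
    and C_max: "shuffle_of_M n (equal_partition n) \<pi>' (\<lambda>i. 1) C_max"
  shows "is_arg_max (copula_integral f) (\<lambda>C. C \<in> copulas) C_max \<and>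
         copula_integral f C_max = 1 / real n * (\<Sum>i=1..n. a i (\<pi>' i))"
proof -
  note f_grid = f[folded grid_interval_def]
  have max_value: "copula_integral f C_max = 1 / real n * (\<Sum>i=1..n. a i (\<pi>' i))"
    by (rule copula_integral_shuffle[OF n C_max]) (rule f_grid)
  have \<pi>': "\<pi>' permutes {1..n}"
    and best: "\<And>\<sigma>. \<sigma> permutes {1..n} \<Longrightarrow> (\<Sum>i=1..n. a i (\<sigma> i)) \<le> (\<Sum>i=1..n. a i (\<pi>' i))"
    using opt by (auto simp: is_arg_max_def not_less)
  have bound: "copula_integral f C \<le> copula_integral f C_max" if C: "C \<in> copulas" for C
  proof -
    have "copula_integral f C = (\<Sum>i\<in>{1..n}. \<Sum>j\<in>{1..n}. a i j * cell_mass C n i j)"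
      by (rule copula_integral_step_function[OF C n]) (rule f_grid)
    also have "\<dots> \<le> 1 / real n * (\<Sum>i=1..n. a i (\<pi>' i))"
    proof (rule doubly_stochastic_le_optimal_assignment)
      show "(\<Sum>i=1..n. a i (\<sigma> i)) \<le> (\<Sum>i=1..n. a i (\<pi>' i))" if "\<sigma> permutes {1..n}" for \<sigma>
        using that by (rule best)
    qed (use \<pi>' cell_mass_sums[OF C n] in \<open>auto simp: cell_mass_def\<close>)
    finally show ?thesis by (simp only: max_value)
  qed
  have "C_max \<in> copulas" using C_max by (simp add: shuffle_of_M_def)
  with bound max_value show ?thesis by (simp add: is_arg_max_def not_less)
qed

end
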